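(* Let $r\geq 2$ and let $m,a$ be integers with $1<m<a$. Define $\mathcal{E}=(e_1,\ldots,e_{3r})$ by $e_1=1$, $e_2=a$, $e_k=e_{k-1}+a-1$ if $k$ is odd and $3\leq k\leq 2r+1$, $e_k=e_{k-1}+(m-1)(2a-1)-(a-1)$ if $k$ is even and $3<k<2r+1$, and $e_k=e_{k-1}+(m-1)(2a-1)$ if $2r+1<k\leq 3r$. Then $\mathcal{E}$ has pattern $(+++-\cdots-+)$, i.e., its prefix coin systems of lengths $1,2,3$ are orderly, its prefix coin systems of lengths $4,\ldots,3r-1$ are not orderly, and $\mathcal{E}$ itself is orderly.
   Context: A coin system is a tuple $(c_1,\ldots,c_n)$ of integers with $c_1=1<c_2<\cdots<c_n$; each coin value may be used any number of times. For a positive integer $v$, $opt(v)$ is the minimum number of coins summing to $v$, and $grd(v)$ is the number of coins used by the greedy algorithm (repeatedly take as many coins as possible of the largest coin value not exceeding the remaining amount). A coin system is orderly if $grd(v)=opt(v)$ for all $v>0$. The prefix coin system of length $i$ is $(c_1,\ldots,c_i)$; the pattern of a coin system is the string whose $i$-th symbol is $+$ if the prefix of length $i$ is orderly and $-$ otherwise. *)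

theory Defs
  imports Main "HOL-Library.Multiset"
begin

definition coin_system :: "int list \<Rightarrow> bool" where
  "coin_system cs \<longleftrightarrow> cs \<noteq> [] \<and> hd cs = 1 \<and> sorted_wrt (<) cs"

text \<open>A payment is a multiset of coin values, so each value may be used any number of times.\<close>

definition opt :: "int list \<Rightarrow> int \<Rightarrow> nat" where
  "opt cs v = (LEAST n. \<exists>M. set_mset M \<subseteq> set cs \<and> sum_mset M = v \<and> size M = n)"

text \<open>The case without a usable coin arises in a coin system exactly when nothing remains to be
  paid, because such a system contains the coin 1.\<close>

function grd :: "int list \<Rightarrow> int \<Rightarrow> nat" where
  "grd cs v =
    (if {c \<in> set cs. 0 < c \<and> c \<le> v} = {} then 0
     else let c = Max {c \<in> set cs. 0 < c \<and> c \<le> v}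
          in nat (v div c) + grd cs (v mod c))"
  by auto
termination
proof (relation "measure (\<lambda>(cs, v). nat v)")
  fix cs :: "int list" and v c :: int
  assume "{c \<in> set cs. 0 < c \<and> c \<le> v} \<noteq> {}" and "c = Max {c \<in> set cs. 0 < c \<and> c \<le> v}"
  then have "c \<in> {c \<in> set cs. 0 < c \<and> c \<le> v}"
    using Max_in[of "{c \<in> set cs. 0 < c \<and> c \<le> v}"] by simp
  then have "0 < c" "c \<le> v" by auto
  then have "v mod c < v" using pos_mod_bound[of c v] by linarith
  with \<open>0 < c\<close> \<open>c \<le> v\<close> show "((cs, v mod c), (cs, v)) \<in> measure (\<lambda>(cs, v). nat v)" by simp
qed simp

declare grd.simps [simp del]

definition orderly :: "int list \<Rightarrow> bool" where
  "orderly cs \<longleftrightarrow> (\<forall>v>0. grd cs v = opt cs v)"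

definition pattern :: "int list \<Rightarrow> string" where
  "pattern cs =
    map (\<lambda>i. if orderly (take i cs) then CHR ''+'' else CHR ''-'') [1..<length cs + 1]"

end

theory Submission
  imports Defs
begin

text \<open>With \<open>b = a - 1\<close>, \<open>p = m - 1\<close> and \<open>d = 2b + 1\<close>, the coins are 1 and two rows \<open>u j = d(1 + jp)\<close>
  for \<open>j \<le> 2r - 2\<close> and \<open>w j = u j - b\<close> for \<open>j \<le> r - 1\<close>, and everything rests on the identity
  \<open>w i + w j = u (i + j) + 1\<close>. In the full system it allows every payment to be brought, without
  more coins, to a form with at most one coin from the row \<open>w\<close> and few ones; the number of these is
  then determined by the amount modulo \<open>d\<close>, and such a payment can be exchanged for one that uses
  the greedy coin. If the largest coin is some \<open>u j\<close> with \<open>0 < j < 2r - 2\<close>, then \<open>u (j + 1) + 1\<close> is a sum of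
  two coins from the row \<open>w\<close>, but the greedy algorithm needs at least three coins. If the largest coin
  is \<open>w j\<close> with \<open>j > 0\<close>, the greedy algorithm fails on \<open>u j\<close>.\<close>

section \<open>Payments and single steps of the greedy algorithm\<close>

text \<open>The relation minimized in \<open>opt\<close>, taken over a set of values so that unions
  of coin rows can be used without listing them.\<close>

definition pays :: "int set \<Rightarrow> nat \<Rightarrow> int \<Rightarrow> bool" where
  "pays S n v \<longleftrightarrow> (\<exists>M. set_mset M \<subseteq> S \<and> sum_mset M = v \<and> size M = n)"

lemma pays_0: "pays S 0 0"
  unfolding pays_def by (rule exI[of _ "{#}"]) simp

lemma pays_add: "pays S n v \<Longrightarrow> pays S k w \<Longrightarrow> pays S (n + k) (v + w)"
  unfolding pays_def
proof (elim exE conjE)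
  fix M N
  assume "set_mset M \<subseteq> S" "sum_mset M = v" "size M = n"
    and "set_mset N \<subseteq> S" "sum_mset N = w" "size N = k"
  then show "\<exists>M. set_mset M \<subseteq> S \<and> sum_mset M = v + w \<and> size M = n + k"
    by (intro exI[of _ "M + N"]) auto
qed

lemma pays_replicate: "c \<in> S \<Longrightarrow> pays S k (int k * c)"
  unfolding pays_def by (rule exI[of _ "replicate_mset k c"]) auto

lemma pays_Suc:
  assumes "c \<in> S" "pays S n v"
  shows "pays S (Suc n) (v + c)"
  using pays_add[OF assms(2) pays_replicate[OF assms(1), of 1]] by simp

lemma pays_induct [consumes 1, case_names zero add]:
  assumes "pays S n v" and "P 0 0"
    and "\<And>n v c. P n v \<Longrightarrow> c \<in> S \<Longrightarrow> P (Suc n) (v + c)"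
  shows "P n v"
proof -
  have "set_mset M \<subseteq> S \<Longrightarrow> P (size M) (sum_mset M)" for M
  proof (induction M)
    case empty
    then show ?case using assms(2) by simp
  next
    case (add c M)
    then show ?case using assms(3)[of "size M" "sum_mset M" c] by (simp add: add.commute)
  qed
  then show ?thesis using assms(1) unfolding pays_def by blast
qed

lemma opt_eq_Least_pays: "opt cs v = (LEAST n. pays (set cs) n v)"
  unfolding opt_def pays_def ..

text \<open>The greedy choice as an order property instead of a \<open>Max\<close>, so that it can
  be checked by comparing with one coin at a time.\<close>

definition greedy_coin :: "int set \<Rightarrow> int \<Rightarrow> int \<Rightarrow> bool" where
  "greedy_coin S v c \<longleftrightarrow> c \<in> S \<and> 0 < c \<and> c \<le> v \<and> (\<forall>x\<in>S. x \<le> v \<longrightarrow> x \<le> c)"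

lemma Max_greedy_coin:
  assumes "greedy_coin (set cs) v c"
  shows "Max {c \<in> set cs. 0 < c \<and> c \<le> v} = c"
  using assms unfolding greedy_coin_def by (intro Max_eqI) auto

lemma grd_0: "v \<le> 0 \<Longrightarrow> grd cs v = 0"
  by (subst grd.simps) auto

text \<open>\<open>grd\<close> takes all copies of the largest coin in one division, while exchange
  arguments remove one coin. If \<open>c\<close> still fits into \<open>v - c\<close>, it is the
  greedy coin there too, with the quotient one less and the same remainder; otherwise the quotient
  of \<open>v\<close> is 1.\<close>

lemma grd_greedy_coin:
  assumes g: "greedy_coin (set cs) v c"
  shows "grd cs v = Suc (grd cs (v - c))"
proof -
  have unfold: "grd cs x = nat (x div c) + grd cs (x mod c)" if "greedy_coin (set cs) x c" for x
  proof -
    have "{c \<in> set cs. 0 < c \<and> c \<le> x} \<noteq> {}"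
      using that unfolding greedy_coin_def by blast
    with Max_greedy_coin[OF that] show ?thesis
      by (subst grd.simps) (simp only: if_False Let_def)
  qed
  have c: "0 < c" "c \<le> v" using g unfolding greedy_coin_def by auto
  have dv: "v div c = (v - c) div c + 1" and md: "(v - c) mod c = v mod c"
    using c div_add_self2[of c "v - c"] by (auto simp: mod_diff_right_eq[symmetric])
  have nn: "0 \<le> (v - c) div c" using c by (simp add: pos_imp_zdiv_nonneg_iff)
  show ?thesis
  proof (cases "c \<le> v - c")
    case True
    then have "greedy_coin (set cs) (v - c) c" using g unfolding greedy_coin_def by auto
    then show ?thesis using unfold[OF g] unfold[of "v - c"] dv md nn by (simp add: nat_add_distrib)
  next
    case False
    have "(v - c) div c = 0" by (rule div_pos_pos_trivial) (use False c in auto)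
    moreover have "(v - c) mod c = v - c" by (rule mod_pos_pos_trivial) (use False c in auto)
    ultimately have "v div c = 1" "v mod c = v - c" using dv md by auto
    then show ?thesis using unfold[OF g] by simp
  qed
qed

lemma ex_greedy_coin:
  assumes "1 \<in> set cs" "0 < v"
  shows "\<exists>c. greedy_coin (set cs) v c"
proof -
  let ?A = "{c \<in> set cs. 0 < c \<and> c \<le> v}"
  have fin: "finite ?A" and "1 \<in> ?A" using assms by auto
  then have max: "Max ?A \<in> ?A" using Max_in[OF fin] by blast
  have "x \<le> Max ?A" if "x \<in> set cs" "x \<le> v" for x
    using that max Max_ge[OF fin, of x] by (cases "0 < x") auto
  then have "greedy_coin (set cs) v (Max ?A)"
    using max unfolding greedy_coin_def by blast
  then show ?thesis ..
qed

lemma pays_grd: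
  assumes "1 \<in> set cs" "0 \<le> v"
  shows "pays (set cs) (grd cs v) v"
  using assms(2)
proof (induction "nat v" arbitrary: v rule: less_induct)
  case less
  show ?case
  proof (cases "v = 0")
    case True
    then show ?thesis by (simp add: grd_0 pays_0)
  next
    case False
    with less.prems have "0 < v" by simp
    then obtain c where g: "greedy_coin (set cs) v c" using ex_greedy_coin[OF assms(1)] by blast
    then have c: "c \<in> set cs" "0 < c" "c \<le> v" unfolding greedy_coin_def by auto
    then have "pays (set cs) (grd cs (v - c)) (v - c)" by (intro less.hyps) auto
    from pays_Suc[OF c(1) this] show ?thesis by (simp add: grd_greedy_coin[OF g])
  qed
qed

lemma grd_ge_2:
  assumes "1 \<in> set cs" "0 < v" "v \<notin> set cs"
  shows "2 \<le> grd cs v"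
proof -
  obtain c where g: "greedy_coin (set cs) v c" using ex_greedy_coin[OF assms(1,2)] by blast
  then have "0 < v - c" using assms(3) unfolding greedy_coin_def by (cases "c = v") auto
  then obtain c' where "greedy_coin (set cs) (v - c) c'" using ex_greedy_coin[OF assms(1)] by blast
  then show ?thesis using grd_greedy_coin[OF g] grd_greedy_coin[of cs "v - c" c'] by simp
qed

lemma grd_only_ones:
  assumes "1 \<in> set cs" "\<And>x. x \<in> set cs \<Longrightarrow> x = 1 \<or> int n < x"
  shows "grd cs (int n) = n"
  using assms(2)
proof (induction n)
  case 0
  then show ?case by (simp add: grd_0)
next
  case (Suc n)
  then have "greedy_coin (set cs) (int (Suc n)) 1"
    using assms(1) unfolding greedy_coin_def by fastforce
  then show ?case using Suc grd_greedy_coin[of cs "int (Suc n)" 1] by fastforce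
qed

section \<open>Criteria for orderliness\<close>

text \<open>Induction on the number of coins gives
  \<open>grd cs v = 1 + grd cs (v - c) \<le> 1 + n' \<le> n\<close> for every payment with
  \<open>n\<close> coins, and by \<open>pays_grd\<close> the greedy payment is itself one of
  them.\<close>

lemma orderlyI:
  assumes one: "1 \<in> set cs"
    and exchange: "\<And>n v. 0 < v \<Longrightarrow> pays (set cs) n v \<Longrightarrow>
      \<exists>c n'. greedy_coin (set cs) v c \<and> n' < n \<and> pays (set cs) n' (v - c)"
  shows "orderly cs"
proof -
  have le: "grd cs v \<le> n" if "pays (set cs) n v" for n v
    using that
  proof (induction n arbitrary: v rule: less_induct)
    case (less n)
    show ?case
    proof (cases "0 < v")
      case True
      then obtain c n' where "greedy_coin (set cs) v c" "n' < n" "pays (set cs) n' (v - c)"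
        using exchange less.prems by blast
      with less.IH[of n' "v - c"] show ?thesis by (simp add: grd_greedy_coin)
    qed (simp add: grd_0)
  qed
  have "grd cs v = opt cs v" if "0 < v" for v
    unfolding opt_eq_Least_pays
    by (rule Least_equality[symmetric]) (use that one in \<open>auto intro: pays_grd le\<close>)
  then show ?thesis unfolding orderly_def by blast
qed

lemma not_orderlyI:
  assumes "0 < v" "pays (set cs) n v" "n < grd cs v"
  shows "\<not> orderly cs"
proof -
  have "opt cs v \<le> n" unfolding opt_eq_Least_pays using assms(2) by (rule Least_le)
  then show ?thesis using assms unfolding orderly_def by force
qed

text \<open>If \<open>a\<close> fits, a payment either contains it or consists of ones,
  \<open>a\<close> of which are traded for it. The value \<open>a = 1\<close> is allowed to cover
  the prefix of length 1.\<close>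

lemma orderly_pair:
  assumes cs: "set cs = {1, a}" and a: "1 \<le> a"
  shows "orderly cs"
proof (rule orderlyI)
  show "1 \<in> set cs" using cs by simp
next
  fix n v
  assume v: "0 < v" and "pays (set cs) n v"
  from this(2) have "\<exists>x y. v = int x + int y * a \<and> x + y = n"
    unfolding cs
  proof (induction rule: pays_induct)
    case (add n v c)
    then obtain x y where "v = int x + int y * a" "x + y = n" by blast
    then have "v + 1 = int (Suc x) + int y * a" "v + a = int x + int (Suc y) * a"
      and "Suc x + y = Suc n" "x + Suc y = Suc n"
      by (auto simp: algebra_simps)
    with add(2) show ?case by blast
  qed simp
  then obtain x y where xy: "v = int x + int y * a" "x + y = n" by blast
  have pays: "pays (set cs) (i + j) (int i + int j * a)" for i j
    using pays_add[OF pays_replicate[of 1 "set cs" i] pays_replicate[of a "set cs" j]] cs by simp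
  show "\<exists>c n'. greedy_coin (set cs) v c \<and> n' < n \<and> pays (set cs) n' (v - c)"
  proof (cases "a \<le> v")
    case True
    then have g: "greedy_coin (set cs) v a" using cs a unfolding greedy_coin_def by auto
    show ?thesis
    proof (cases y)
      case 0
      then have "pays (set cs) (nat (int x - a)) (v - a)"
        using pays[of "nat (int x - a)" 0] xy True by simp
      then show ?thesis using g xy 0 a True
        by (intro exI[of _ a] exI[of _ "nat (int x - a)"]) auto
    next
      case (Suc y')
      then have "pays (set cs) (x + y') (v - a)"
        using pays[of x y'] xy by (simp add: algebra_simps)
      then show ?thesis using g xy Suc by (intro exI[of _ a] exI[of _ "x + y'"]) auto
    qed
  next
    case False
    then have g: "greedy_coin (set cs) v 1" using cs a v unfolding greedy_coin_def by auto
    have "y = 0"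
    proof (rule ccontr)
      assume "y \<noteq> 0"
      then have "1 * a \<le> int y * a" using a by (intro mult_right_mono) auto
      then show False using False xy by simp
    qed
    then have "0 < x" using v xy by simp
    then show ?thesis using g pays[of "x - 1" 0] xy \<open>y = 0\<close>
      by (intro exI[of _ 1] exI[of _ "x - 1"]) (auto simp: of_nat_diff)
  qed
qed

section \<open>The two rows of coins\<close>

locale two_row =
  fixes b p :: int and R :: nat
  assumes b: "0 < b" and p: "0 < p"
begin

definition d :: int where "d = 2 * b + 1"

definition u :: "nat \<Rightarrow> int" where "u j = d * (1 + int j * p)"

definition w :: "nat \<Rightarrow> int" where "w j = u j - b"

text \<open>\<open>R = r - 1\<close> gives the full system, and \<open>R = 0\<close> gives its
  prefix of length 3.\<close>

definition coins :: "int set" where "coins = insert 1 (w ` {..R} \<union> u ` {..2 * R})"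

text \<open>The value of \<open>x\<close> coins 1, \<open>y\<close> coins from the row \<open>w\<close> and \<open>z\<close> coins from the row \<open>u\<close>, where
  \<open>J\<close> is the sum of the indices of the latter \<open>y + z\<close> coins.\<close>

definition val :: "nat \<Rightarrow> nat \<Rightarrow> nat \<Rightarrow> nat \<Rightarrow> int" where
  "val x y z J = int x - int y * b + (int y + int z) * d + p * d * int J"

lemma d_pos: "0 < d" and b_less_d: "b < d"
  using b by (auto simp: d_def)

lemma u_Suc: "u (Suc j) = u j + p * d"
  by (simp add: u_def algebra_simps)

lemma pd_ge: "d \<le> p * d"
  using p d_pos mult_right_mono[of 1 p d] by simp

lemma u_mono: "i \<le> j \<Longrightarrow> u i \<le> u j"
  using p d_pos by (auto simp: u_def intro!: mult_left_mono mult_right_mono)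

text \<open>The rows interleave: consecutive \<open>u\<close> differ by
  \<open>p * d \<ge> d > b\<close>, and each \<open>w\<close> lies only \<open>b\<close> below its
  \<open>u\<close>.\<close>

lemma u_less_w: "i < j \<Longrightarrow> u i < w j"
  using u_mono[of "Suc i" j] u_Suc[of i] pd_ge b_less_d unfolding w_def by simp

lemma w_less_u: "w i < u i"
  using b by (simp add: w_def)

lemma w_mono: "i \<le> j \<Longrightarrow> w i \<le> w j"
  using u_mono by (simp add: w_def)

lemma u_ge_d: "d \<le> u i"
  using u_mono[of 0 i] by (simp add: u_def)

lemma w_ge: "b + 1 \<le> w i"
  using u_ge_d[of i] by (simp add: w_def d_def)

text \<open>The choice of \<open>d\<close> makes \<open>d - 2 * b = 1\<close>.\<close>

lemma w_add_w: "w i + w j = u (i + j) + 1"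
  by (simp add: w_def u_def d_def algebra_simps)

lemma coin_cases:
  assumes "c \<in> coins"
  obtains "c = 1" | i where "i \<le> R" "c = w i" | i where "i \<le> 2 * R" "c = u i"
  using assms unfolding coins_def by auto

lemma coins_memb: "1 \<in> coins" "i \<le> R \<Longrightarrow> w i \<in> coins" "i \<le> 2 * R \<Longrightarrow> u i \<in> coins"
  unfolding coins_def by auto

section \<open>Normal form of payments and the exchange\<close>

text \<open>Only the sum of the indices matters. A coin from the row \<open>w\<close> carries an
  index up to \<open>R\<close>, one from the row \<open>u\<close> up to \<open>2 * R\<close>; if
  each coin takes as much of \<open>J\<close> as it can, the rest fits the remaining coins.\<close>

lemma pays_val:
  assumes "J \<le> R * (y + 2 * z)"
  shows "pays coins (x + y + z) (val x y z J)"
proof -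
  have "pays coins (y + z) (val 0 y z J)"
    using assms
  proof (induction y arbitrary: J)
    case 0
    then show ?case
    proof (induction z arbitrary: J)
      case 0
      then show ?case by (simp add: val_def pays_0)
    next
      case (Suc z)
      define i where "i = min J (2 * R)"
      have "J - i \<le> R * (0 + 2 * z)" using Suc.prems by (auto simp: i_def algebra_simps)
      from pays_Suc[OF coins_memb(3)[of i] Suc.IH[OF this]]
      have "pays coins (Suc (0 + z)) (val 0 0 z (J - i) + u i)" by (simp add: i_def)
      moreover have "val 0 0 z (J - i) + u i = val 0 0 (Suc z) J"
        by (simp add: val_def u_def i_def of_nat_diff algebra_simps)
      ultimately show ?case by simp
    qed
  next
    case (Suc y)
    define i where "i = min J R"
    have "J - i \<le> R * (y + 2 * z)" using Suc.prems by (auto simp: i_def algebra_simps)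
    from pays_Suc[OF coins_memb(2)[of i] Suc.IH[OF this]]
    have "pays coins (Suc (y + z)) (val 0 y z (J - i) + w i)" by (simp add: i_def)
    moreover have "val 0 y z (J - i) + w i = val 0 (Suc y) z J"
      by (simp add: val_def w_def u_def i_def of_nat_diff algebra_simps)
    ultimately show ?case by simp
  qed
  from pays_add[OF this pays_replicate[OF coins_memb(1), of x]] show ?thesis
    by (simp add: val_def algebra_simps)
qed

text \<open>Two coins \<open>w i\<close> and \<open>w j\<close> are traded for \<open>u (i + j)\<close> and a 1; then \<open>b + 1\<close> ones are worth \<open>w 0\<close>,
  and \<open>w i\<close> with \<open>b\<close> ones is worth \<open>u i\<close>.\<close>

lemma pays_normalized:
  assumes "pays coins n v"
  shows "\<exists>x y z J. v = val x y z J \<and> y \<le> 1 \<and> int x + int y \<le> b \<and> J \<le> R * (y + 2 * z) \<and>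
    x + y + z \<le> n"
  using assms
proof (induction rule: pays_induct)
  case zero
  show ?case using b by (intro exI[of _ 0]) (simp add: val_def)
next
  case (add n v c)
  then obtain x y z J where v: "v = val x y z J" and y: "y \<le> 1" and x: "int x + int y \<le> b"
    and J: "J \<le> R * (y + 2 * z)" and n: "x + y + z \<le> n"
    by blast
  have y01: "y = 0 \<or> y = 1" using y by auto
  from add(2) show ?case
  proof (cases rule: coin_cases)
    case 1
    consider "int x + int y < b" | "y = 0" "int x = b" | "y = 1" "int x = b - 1"
      using x y01 by fastforce
    then show ?thesis
    proof cases
      case 1
      then show ?thesis using v y J n \<open>c = 1\<close>
        by (intro exI[of _ "Suc x"] exI[of _ y] exI[of _ z] exI[of _ J]) (auto simp: val_def)
    next
      case 2
      then show ?thesis using v y J n b \<open>c = 1\<close>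
        by (intro exI[of _ 0] exI[of _ 1] exI[of _ z] exI[of _ J]) (auto simp: val_def d_def algebra_simps)
    next
      case 3
      then show ?thesis using v y J n b \<open>c = 1\<close>
        by (intro exI[of _ 0] exI[of _ "Suc z"] exI[of _ J]) (auto simp: val_def algebra_simps)
    qed
  next
    case (2 i)
    consider "y = 0" "int x < b" | "y = 0" "int x = b" | "y = 1"
      using x y01 by fastforce
    then show ?thesis
    proof cases
      case 1
      then show ?thesis using v J n 2
        by (intro exI[of _ x] exI[of _ 1] exI[of _ z] exI[of _ "J + i"])
          (auto simp: val_def w_def u_def algebra_simps)
    next
      case 2
      then show ?thesis using v J n b \<open>i \<le> R\<close> \<open>c = w i\<close>
        by (intro exI[of _ 0] exI[of _ "Suc z"] exI[of _ "J + i"])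
          (auto simp: val_def w_def u_def algebra_simps)
    next
      case 3
      then show ?thesis using v J n x \<open>i \<le> R\<close> \<open>c = w i\<close>
        by (intro exI[of _ "Suc x"] exI[of _ 0] exI[of _ "Suc z"] exI[of _ "J + i"])
          (auto simp: val_def w_def u_def d_def algebra_simps)
    qed
  next
    case (3 i)
    then show ?thesis using v y x J n
      by (intro exI[of _ x] exI[of _ y] exI[of _ "Suc z"] exI[of _ "J + i"])
        (auto simp: val_def u_def algebra_simps)
  qed
qed

text \<open>In normal form, \<open>x\<close> and \<open>y\<close> are fixed by \<open>v\<close>
  modulo \<open>d\<close>. When the greedy coin is from the row \<open>u\<close>, they are kept, and
  it suffices to pay the remaining multiple of \<open>d\<close> with fewer than \<open>z\<close>
  coins from that row.\<close>

lemma exchange: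
  assumes v: "0 < v" and "pays coins n v"
  shows "\<exists>c n'. greedy_coin coins v c \<and> n' < n \<and> pays coins n' (v - c)"
proof -
  obtain x y z J where v_val: "v = val x y z J" and y: "y \<le> 1" and x: "int x + int y \<le> b"
    and J: "J \<le> R * (y + 2 * z)" and n: "x + y + z \<le> n"
    using pays_normalized[OF assms(2)] by blast
  have y01: "y = 0 \<or> y = 1" using y by auto
  \<comment> \<open>\<open>q\<close> and \<open>s\<close> are the quotient and remainder of
    \<open>v\<close> by \<open>d\<close>: for \<open>y = 0\<close> the remainder is
    \<open>x \<le> b\<close>, for \<open>y = 1\<close> it is \<open>x + b + 1\<close>, between
    \<open>b + 1\<close> and \<open>2 * b\<close>.\<close>
  define s where "s = int x - int y * b + int y * d"
  define q where "q = int z + p * int J"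
  have s: "0 \<le> s" "s < d" using y01 x b by (auto simp: s_def d_def)
  have v_qs: "v = q * d + s" by (simp add: v_val val_def s_def q_def algebra_simps)
  have q0: "0 \<le> q" using p by (simp add: q_def)
  consider "u (2 * R) \<le> v" | "v < d" | "v < u (2 * R)" "d \<le> v" by linarith
  then show ?thesis
  proof cases
    case 1
    have g: "greedy_coin coins v (u (2 * R))"
      unfolding greedy_coin_def
    proof (intro conjI ballI impI)
      show "0 < u (2 * R)" using u_ge_d[of "2 * R"] d_pos by linarith
      fix c assume "c \<in> coins"
      then show "c \<le> u (2 * R)"
      proof (cases rule: coin_cases)
        case 1
        then show ?thesis using u_ge_d[of "2 * R"] d_pos by linarith
      next
        case (2 i)
        then show ?thesis using w_less_u[of i] u_mono[of i "2 * R"] by simp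
      qed (simp add: u_mono)
    qed (use 1 in \<open>auto intro: coins_memb\<close>)
    have "d * (1 + 2 * int R * p) \<le> q * d + s" using 1 by (simp add: u_def v_qs)
    moreover have "q * d + d = d * (q + 1)" by (simp add: algebra_simps)
    ultimately have "d * (1 + 2 * int R * p) < d * (q + 1)" using s by linarith
    then have q: "1 + 2 * int R * p \<le> q" using d_pos by simp
    have "0 < z"
    proof (rule ccontr)
      assume "\<not> 0 < z"
      then have "z = 0" "J \<le> R" using J y01 by auto
      then have "p * int J \<le> p * (2 * int R)" using p by (intro mult_left_mono) auto
      then show False using q \<open>z = 0\<close> by (simp add: q_def algebra_simps)
    qed
    show ?thesis
    \<comment> \<open>If the index sum allows it, one coin is removed together with
      \<open>2 * R\<close> from \<open>J\<close>. Otherwise all indices are reset to 0, and the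
      remaining quotient is paid by \<open>z'\<close> coins \<open>u 0 = d\<close>.\<close>
    proof (cases "2 * R \<le> J")
      case True
      have "J - 2 * R \<le> R * (y + 2 * (z - 1))" using J \<open>0 < z\<close>
        by (cases z) (auto simp: algebra_simps)
      from pays_val[OF this, of x] have "pays coins (x + y + (z - 1)) (v - u (2 * R))"
        using True \<open>0 < z\<close> by (simp add: v_val val_def u_def of_nat_diff algebra_simps)
      then show ?thesis using g n \<open>0 < z\<close> by (intro exI[of _ "u (2 * R)"] exI[of _ "x + y + (z - 1)"]) auto
    next
      case False
      define z' where "z' = nat (q - 1 - 2 * int R * p)"
      have "p * int J \<le> p * (2 * int R)" using p False by (intro mult_left_mono) auto
      moreover have z': "int z' = q - 1 - 2 * int R * p" using q by (simp add: z'_def)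
      moreover have "2 * int R * p = p * (2 * int R)" by simp
      ultimately have "int z' < int z" by (simp add: q_def)
      then have "z' < z" by simp
      have "val x y z' 0 = v - u (2 * R)"
        unfolding v_qs val_def by (simp add: z' u_def s_def algebra_simps)
      then have "pays coins (x + y + z') (v - u (2 * R))" using pays_val[of 0 y z' x] by simp
      then show ?thesis using g n \<open>z' < z\<close>
        by (intro exI[of _ "u (2 * R)"] exI[of _ "x + y + z'"]) auto
    qed
  next
    case 2
    have "q = 0"
    proof (rule ccontr)
      assume "q \<noteq> 0"
      then have "1 * d \<le> q * d" using q0 d_pos by (intro mult_right_mono) auto
      then show False using 2 s unfolding v_qs by linarith
    qed
    then have "int z = 0 \<and> p * int J = 0" using p by (simp add: q_def add_nonneg_eq_0_iff)
    then have zJ: "z = 0" "J = 0" using p by auto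
    have small: "c = 1 \<or> c = w 0" if "c \<in> coins" "c \<le> v" for c
      using that(1)
    proof (cases rule: coin_cases)
      case (2 i)
      then show ?thesis using that(2) \<open>v < d\<close> u_less_w[of 0 i] u_ge_d[of 0] by (cases i) auto
    next
      case (3 i)
      then show ?thesis using that(2) \<open>v < d\<close> u_ge_d[of i] by simp
    qed simp
    from y01 show ?thesis
    proof
      assume "y = 0"
      then have vx: "v = int x" "v < w 0" using v_val zJ x w_ge[of 0] by (auto simp: val_def)
      then have "greedy_coin coins v 1"
        using small v unfolding greedy_coin_def by (auto intro: coins_memb)
      moreover have "pays coins (x - 1) (v - 1)"
        using pays_val[of 0 0 0 "x - 1"] vx v by (simp add: val_def of_nat_diff)
      ultimately show ?thesis using n vx v by (intro exI[of _ 1] exI[of _ "x - 1"]) auto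
    next
      assume "y = 1"
      then have vx: "v = int x + w 0" using v_val zJ by (simp add: val_def w_def u_def)
      have "c \<le> w 0" if "c \<in> coins" "c \<le> v" for c
        using small[OF that] w_ge[of 0] b by auto
      with vx have "greedy_coin coins v (w 0)"
        using w_ge[of 0] b unfolding greedy_coin_def by (auto intro: coins_memb)
      moreover have "pays coins x (v - w 0)"
        using pays_val[of 0 0 0 x] vx by (simp add: val_def)
      ultimately show ?thesis using n \<open>y = 1\<close> by (intro exI[of _ "w 0"] exI[of _ x]) auto
    qed
  next
    case 3
    have "0 < q"
    proof (rule ccontr)
      assume "\<not> 0 < q"
      then have "q = 0" using q0 by simp
      then show False using 3 s by (simp add: v_qs)
    qed
    \<comment> \<open>Division of \<open>q - 1\<close> by \<open>p\<close> makes \<open>u j\<close>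
      the largest value of the row \<open>u\<close> not above \<open>v\<close>, with
      \<open>v - u j = t * d + s\<close>.\<close>
    define j t where "j = nat ((q - 1) div p)" and "t = nat ((q - 1) mod p)"
    have "0 \<le> (q - 1) div p" "0 \<le> (q - 1) mod p" "int t < p"
      using p \<open>0 < q\<close> by (auto simp: t_def pos_imp_zdiv_nonneg_iff)
    then have q: "q = 1 + p * int j + int t" and t: "int t < p"
      by (auto simp: j_def t_def)
    have v_less: "v < u (Suc j)"
    proof -
      have "(q + 1) * d \<le> (1 + p * int j + p) * d"
        using d_pos q t by (intro mult_right_mono) auto
      then show ?thesis using s by (simp add: v_qs u_def algebra_simps)
    qed
    have v_ge: "u j \<le> v"
    proof -
      have "(1 + p * int j) * d \<le> q * d"
        using d_pos q by (intro mult_right_mono) auto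
      then show ?thesis using s by (simp add: v_qs u_def algebra_simps)
    qed
    have j: "j \<le> 2 * R"
      using u_mono[of "2 * R" j] v_ge 3 by linarith
    show ?thesis
    \<comment> \<open>This is exactly when \<open>w (Suc j)\<close> is a coin not exceeding
      \<open>v\<close>: since \<open>w (Suc j) - u j = (p - 1) * d + b + 1\<close>, it requires
      \<open>t = p - 1\<close> and \<open>s \<ge> b + 1\<close>. The remainder is then
      \<open>x\<close> ones.\<close>
    proof (cases "y = 1 \<and> int t = p - 1 \<and> Suc j \<le> R")
      case True
      have v_eq: "v = int x + w (Suc j)"
      proof -
        have "p = int t + 1" and y: "y = 1" using True by auto
        then have "p * d = int t * d + d" by (simp add: distrib_right)
        with y show ?thesis by (simp add: v_qs s_def q w_def u_def algebra_simps)
      qed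
      have "greedy_coin coins v (w (Suc j))"
        unfolding greedy_coin_def
      proof (intro conjI ballI impI)
        show "0 < w (Suc j)" using w_ge[of "Suc j"] b by linarith
        fix c assume "c \<in> coins" and c: "c \<le> v"
        from this(1) show "c \<le> w (Suc j)"
        proof (cases rule: coin_cases)
          case 1
          then show ?thesis using w_ge[of "Suc j"] b by linarith
        next
          case (2 i)
          have "\<not> Suc j < i" using u_less_w[of "Suc j" i] 2 c v_less by auto
          then show ?thesis using 2 w_mono[of i "Suc j"] by simp
        next
          case (3 i)
          have "\<not> Suc j \<le> i" using u_mono[of "Suc j" i] 3 c v_less by auto
          then show ?thesis using 3 u_less_w[of i "Suc j"] by simp
        qed
      qed (use True v_eq in \<open>auto intro: coins_memb\<close>)
      moreover have "pays coins x (v - w (Suc j))"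
        using pays_val[of 0 0 0 x] v_eq by (simp add: val_def)
      ultimately show ?thesis using n True by (intro exI[of _ "w (Suc j)"] exI[of _ x]) auto
    next
      case False
      have v_less_w: "v < w (Suc j)" if "Suc j \<le> R"
        using y01
      proof
        assume "y = 0"
        then have "s \<le> b" using x by (simp add: s_def)
        moreover have "q * d \<le> (p + p * int j) * d"
          using d_pos q t by (intro mult_right_mono) auto
        ultimately show ?thesis using b by (simp add: v_qs w_def u_def d_def algebra_simps)
      next
        assume "y = 1"
        then have "int t \<le> p - 2" using False that t by simp
        then have "(q + 1) * d \<le> (p + p * int j) * d"
          using d_pos q by (intro mult_right_mono) auto
        then show ?thesis using b s by (simp add: v_qs w_def u_def d_def algebra_simps)
      qed
      have g: "greedy_coin coins v (u j)"
        unfolding greedy_coin_def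
      proof (intro conjI ballI impI)
        show "0 < u j" using u_ge_d[of j] d_pos by linarith
        fix c assume "c \<in> coins" and c: "c \<le> v"
        from this(1) show "c \<le> u j"
        proof (cases rule: coin_cases)
          case 1
          then show ?thesis using u_ge_d[of j] d_pos by linarith
        next
          case (2 i)
          have "\<not> Suc j \<le> i" using w_mono[of "Suc j" i] 2 c v_less_w by auto
          then show ?thesis using 2 w_less_u[of i] u_mono[of i j] by simp
        next
          case (3 i)
          have "\<not> Suc j \<le> i" using u_mono[of "Suc j" i] 3 c v_less by auto
          then show ?thesis using 3 u_mono[of i j] by simp
        qed
      qed (use j v_ge in \<open>auto intro: coins_memb\<close>)
      \<comment> \<open>From \<open>z + p * J = 1 + p * j + t\<close>, the case
        \<open>J \<le> j\<close> is immediate. A larger \<open>J\<close> forces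
        \<open>z = 0\<close>, \<open>t = p - 1\<close> and \<open>J = Suc j\<close>; a single coin
        from the row \<open>w\<close> must then carry this index, which is the case already
        excluded.\<close>
      have "t < z"
      proof (cases "J \<le> j")
        case True
        then have "p * int J \<le> p * int j" using p by (intro mult_left_mono) auto
        then show ?thesis using q by (simp add: q_def)
      next
        case False
        then have "p * int (Suc j) \<le> p * int J" using p by (intro mult_left_mono) auto
        then have "z = 0" "int t = p - 1" "p * int (Suc j) = p * int J"
          using q t by (auto simp: q_def algebra_simps)
        then have "J = Suc j" using p by simp
        then have "y = 1 \<and> Suc j \<le> R" using J \<open>z = 0\<close> y01 by auto
        then show ?thesis
          using \<open>int t = p - 1\<close> \<open>\<not> (y = 1 \<and> int t = p - 1 \<and> Suc j \<le> R)\<close> by simp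
      qed
      moreover have "val x y t 0 = v - u j"
        by (simp add: val_def v_qs q s_def u_def algebra_simps)
      then have "pays coins (x + y + t) (v - u j)" using pays_val[of 0 y t x] by simp
      ultimately show ?thesis using g n by (intro exI[of _ "u j"] exI[of _ "x + y + t"]) auto
    qed
  qed
qed

lemma orderly_coins:
  assumes "set cs = coins"
  shows "orderly cs"
  by (rule orderlyI) (use assms exchange coins_memb(1) in simp_all)

section \<open>Prefixes that are not orderly\<close>

text \<open>The rows without a bound on the index, a common superset for all prefixes.\<close>

definition rows :: "int set" where "rows = insert 1 (range w \<union> range u)"

lemma coins_subset_rows: "coins \<subseteq> rows"
  unfolding coins_def rows_def by auto

lemma rows_gt: "c \<in> rows \<Longrightarrow> c = 1 \<or> b < c"
  using w_ge u_ge_d b_less_d unfolding rows_def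
  by (auto simp: add1_zle_eq intro: order.strict_trans2)

text \<open>Modulo \<open>d\<close>, the row \<open>u\<close> is 0 and the row \<open>w\<close> is
  \<open>b + 1\<close>, and neither is congruent to 1; the coin 1 itself is too small.\<close>

lemma pd_Suc_notin_rows: "p * d + 1 \<notin> rows"
proof -
  have "p * d + 1 \<noteq> u j" for j
  proof
    assume "p * d + 1 = u j"
    then have "d * (1 + int j * p - p) = 1" by (simp add: u_def algebra_simps)
    then have "d dvd 1" by (metis dvd_triv_left)
    then show False using b by (simp add: d_def zdvd1_eq)
  qed
  moreover have "p * d + 1 \<noteq> w j" for j
  proof
    assume "p * d + 1 = w j"
    then have "b + 1 = d * (1 + int j * p - p)" by (simp add: w_def u_def algebra_simps)
    then have "d dvd b + 1" by (metis dvd_triv_left)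
    then show False using zdvd_imp_le[of d "b + 1"] b by (simp add: d_def)
  qed
  ultimately show ?thesis using p d_pos unfolding rows_def by auto
qed

text \<open>The greedy algorithm pays \<open>u (Suc j)\<close> as \<open>w (Suc j)\<close> and \<open>b\<close> ones, although \<open>u j\<close> and
  \<open>p\<close> coins \<open>u 0\<close> suffice.\<close>

lemma not_orderly_max_w:
  assumes "p < b" and cs: "set cs \<subseteq> rows" "{1, u 0, u j, w (Suc j)} \<subseteq> set cs"
    and max: "\<And>c. c \<in> set cs \<Longrightarrow> c \<le> w (Suc j)"
  shows "\<not> orderly cs"
proof (rule not_orderlyI)
  show "0 < u (Suc j)" using u_ge_d[of "Suc j"] d_pos by linarith
  have "pays (set cs) (nat p) (p * d)"
    using pays_replicate[of "u 0" "set cs" "nat p"] cs p by (simp add: u_def)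
  from pays_Suc[OF _ this, of "u j"] cs
  show "pays (set cs) (Suc (nat p)) (u (Suc j))" by (simp add: u_Suc add.commute)
  have "greedy_coin (set cs) (u (Suc j)) (w (Suc j))"
    using cs max w_less_u[of "Suc j"] w_ge[of "Suc j"] b unfolding greedy_coin_def by auto
  then have "grd cs (u (Suc j)) = Suc (grd cs (int (nat b)))"
    using b by (simp add: grd_greedy_coin w_def)
  also have "grd cs (int (nat b)) = nat b"
    using cs rows_gt b by (intro grd_only_ones) auto
  finally show "Suc (nat p) < grd cs (u (Suc j))" using \<open>p < b\<close> p by simp
qed

text \<open>By \<open>w_add_w\<close>, \<open>w (Suc i) + w j\<close> is
  \<open>u (Suc (i + j)) + 1\<close>. After the greedy coin \<open>u (i + j)\<close> the amount
  \<open>p * d + 1\<close> is left, which is not a coin and so costs at least two more.\<close>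

lemma not_orderly_max_u:
  assumes cs: "set cs \<subseteq> rows" "{1, u (i + j), w (Suc i), w j} \<subseteq> set cs"
    and max: "\<And>c. c \<in> set cs \<Longrightarrow> c \<le> u (i + j)"
  shows "\<not> orderly cs"
proof (rule not_orderlyI)
  let ?v = "u (Suc (i + j)) + 1"
  have u_pos: "0 < u (i + j)" using u_ge_d[of "i + j"] d_pos by linarith
  have pd: "0 < p * d + 1" using p d_pos by (simp add: add_pos_pos)
  show "0 < ?v" using u_pos pd by (simp add: u_Suc)
  show "pays (set cs) 2 ?v"
    using pays_Suc[OF _ pays_Suc[OF _ pays_0], of "w j" "set cs" "w (Suc i)"] cs w_add_w[of "Suc i" j]
    by (simp add: numeral_2_eq_2)
  have "greedy_coin (set cs) ?v (u (i + j))"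
    using cs max u_pos pd unfolding greedy_coin_def by (auto simp: u_Suc)
  then have "grd cs ?v = Suc (grd cs (p * d + 1))"
    by (simp add: grd_greedy_coin u_Suc)
  moreover have "2 \<le> grd cs (p * d + 1)"
    using cs pd_Suc_notin_rows pd by (intro grd_ge_2) auto
  ultimately show "2 < grd cs ?v" by simp
qed

end

section \<open>The sequence \<open>e\<close> in terms of the two rows\<close>

theorem theorem4p5:
  fixes r :: nat and m a :: int and e :: "nat \<Rightarrow> int"
  assumes "r \<ge> 2" and "1 < m" and "m < a"
    and "e 1 = 1" and "e 2 = a"
    and "\<And>k. odd k \<Longrightarrow> 3 \<le> k \<Longrightarrow> k \<le> 2 * r + 1 \<Longrightarrow> e k = e (k - 1) + a - 1"
    and "\<And>k. even k \<Longrightarrow> 3 < k \<Longrightarrow> k < 2 * r + 1 \<Longrightarrow>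
           e k = e (k - 1) + (m - 1) * (2 * a - 1) - (a - 1)"
    and "\<And>k. 2 * r + 1 < k \<Longrightarrow> k \<le> 3 * r \<Longrightarrow> e k = e (k - 1) + (m - 1) * (2 * a - 1)"
  shows "coin_system (map e [1..<3 * r + 1]) \<and>
         pattern (map e [1..<3 * r + 1]) = ''+++'' @ replicate (3 * r - 4) CHR ''-'' @ ''+''"
proof -
  interpret two_row "a - 1" "m - 1" "r - 1" using assms(2,3) by unfold_locales auto
  interpret short: two_row "a - 1" "m - 1" 0 using assms(2,3) by unfold_locales auto
  note odd = assms(6) and even = assms(7) and high = assms(8)
  have d_eq: "d = 2 * a - 1" by (simp add: d_def)
  have step: "e k < e (Suc k)" if "1 \<le> k" "k < 3 * r" for k
  proof -
    have "k = 1 \<or> 2 \<le> k" using that by linarith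
    then consider "k = 1" | "2 \<le> k" "odd (Suc k)" "Suc k \<le> 2 * r + 1"
      | "2 \<le> k" "even (Suc k)" "Suc k \<le> 2 * r + 1" | "2 * r + 1 < Suc k"
      by (metis not_less)
    then show ?thesis
    proof cases
      case 1
      then show ?thesis using assms(2-5) by (simp add: numeral_2_eq_2)
    next
      case 2
      then show ?thesis using odd[of "Suc k"] assms(2,3) by simp
    next
      case 3
      then have "3 < Suc k" "Suc k < 2 * r + 1" by (auto elim!: oddE) presburger
      then have "e (Suc k) = e k + (m - 1) * d - (a - 1)"
        using 3 even[of "Suc k"] by (simp add: d_eq)
      then show ?thesis using pd_ge b_less_d by linarith
    next
      case 4
      then have "e (Suc k) = e k + (m - 1) * d" using that high[of "Suc k"] by (simp add: d_eq)
      then show ?thesis using pd_ge d_pos by linarith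
    qed
  qed
  have less: "e i < e j" if "1 \<le> i" "i < j" "j \<le> 3 * r" for i j
    using that(2,3)
  proof (induction j)
    case (Suc j)
    then show ?case using step[of j] that(1) by (cases "i = j") force+
  qed simp
  \<comment> \<open>Up to position \<open>2 * r + 1\<close> the rows alternate: the odd steps add
    \<open>b\<close>, leading from \<open>w j\<close> to \<open>u j\<close>, and the even steps add
    \<open>p * d - b\<close>, leading from \<open>u j\<close> to \<open>w (Suc j)\<close>.\<close>
  have e_low: "e (2 * j + 2) = w j \<and> e (2 * j + 3) = u j" if "j < r" for j
    using that
  proof (induction j)
    case 0
    have "e 3 = e 2 + a - 1" using odd[of 3] assms(1) by simp
    then show ?case using assms(5)
      by (simp add: w_def u_def d_eq del: One_nat_def add_2_eq_Suc' add_2_eq_Suc)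
  next
    case (Suc j)
    have "2 * Suc j + 2 - 1 = 2 * j + 3" "2 * Suc j + 3 - 1 = 2 * Suc j + 2" by auto
    with even[of "2 * Suc j + 2"] odd[of "2 * Suc j + 3"] Suc.prems
    have "e (2 * Suc j + 2) = e (2 * j + 3) + (m - 1) * d - (a - 1)"
      and "e (2 * Suc j + 3) = e (2 * Suc j + 2) + a - 1"
      by (simp_all only: d_eq) simp_all
    moreover from this(1) have "e (2 * Suc j + 2) = w (Suc j)"
      using Suc by (simp add: w_def u_Suc)
    ultimately show ?case by (simp add: w_def)
  qed
  \<comment> \<open>From there on only the row \<open>u\<close> continues, up to
    \<open>u (2 * r - 2)\<close> at position \<open>3 * r\<close>. The case \<open>i = 0\<close> is
    the last coin of \<open>e_low\<close>.\<close>
  have e_high: "e (2 * r + 1 + i) = u (r - 1 + i)" if "i < r" for i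
    using that
  proof (induction i)
    case 0
    then show ?case using e_low[of "r - 1"] by (cases r) (auto simp: numeral_eq_Suc)
  next
    case (Suc i)
    then show ?case using high[of "2 * r + 1 + Suc i"] u_Suc[of "r - 1 + i"] by (simp add: d_eq)
  qed
  have index_cases: thesis if
    "1 \<le> k" "k \<le> 3 * r" and "k = 1 \<Longrightarrow> thesis"
      and "\<And>j. j < r \<Longrightarrow> k = 2 * j + 2 \<Longrightarrow> thesis"
      and "\<And>j. j < r \<Longrightarrow> k = 2 * j + 3 \<Longrightarrow> thesis"
      and "\<And>i. 0 < i \<Longrightarrow> i < r \<Longrightarrow> k = 2 * r + 1 + i \<Longrightarrow> thesis" for k thesis
  proof -
    have "k = 1 \<or> 2 \<le> k" using that(1) by linarith
    then consider "k = 1" | "2 \<le> k" "k \<le> 2 * r + 1" "even k" | "2 \<le> k" "k \<le> 2 * r + 1" "odd k"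
      | "2 * r + 1 < k"
      by (metis not_less)
    then show thesis
    proof cases
      case 1
      then show thesis by (rule that(3))
    next
      case 2
      then have "k div 2 - 1 < r" "k = 2 * (k div 2 - 1) + 2" by presburger+
      then show thesis by (rule that(4))
    next
      case 3
      then have "k div 2 - 1 < r" "k = 2 * (k div 2 - 1) + 3" by presburger+
      then show thesis by (rule that(5))
    next
      case 4
      then show thesis using that(2) by (intro that(6)[of "k - (2 * r + 1)"]) auto
    qed
  qed
  have e_coins: "e k \<in> coins" if "1 \<le> k" "k \<le> 3 * r" for k
  proof (rule index_cases[OF that])
    assume "k = 1"
    then show ?thesis using assms(4) coins_memb(1) by simp
  next
    fix j assume j: "j < r" "k = 2 * j + 2"
    then show ?thesis using e_low[OF j(1)] coins_memb(2)[of j] by simp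
  next
    fix j assume j: "j < r" "k = 2 * j + 3"
    then show ?thesis using e_low[OF j(1)] coins_memb(3)[of j] by simp
  next
    fix i assume i: "i < r" "k = 2 * r + 1 + i"
    then show ?thesis using e_high[OF i(1)] coins_memb(3)[of "r - 1 + i"] by simp
  qed
  define C where "C i = map e [1..<i + 1]" for i
  have set_C: "set (C i) = e ` {1..i}" for i by (auto simp: C_def)
  have max_C: "c \<le> e i" if "c \<in> set (C i)" "i \<le> 3 * r" for c i
    using that less[of _ i] by (fastforce simp: set_C le_less)
  have C_rows: "set (C i) \<subseteq> rows" if "i \<le> 3 * r" for i
    using that e_coins coins_subset_rows by (fastforce simp: set_C)
  have e_memb: "e k \<in> set (C i)" if "1 \<le> k" "k \<le> i" for i k
    using that by (simp add: set_C)
  have memb_C: "1 \<in> set (C i)" if "1 \<le> i" for i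
    using e_memb[of 1 i] that assms(4) by simp
  have w_memb: "w j \<in> set (C i)" if "j < r" "2 * j + 2 \<le> i" for i j
    using e_memb[of "2 * j + 2" i] e_low[OF that(1)] that(2) by simp
  have u_memb: "u j \<in> set (C i)" if "j < r" "2 * j + 3 \<le> i" for i j
    using e_memb[of "2 * j + 3" i] e_low[OF that(1)] that(2) by simp
  have u_memb': "u (r - 1 + j) \<in> set (C i)" if "j < r" "2 * r + 1 + j \<le> i" for i j
    using e_memb[of "2 * r + 1 + j" i] e_high[OF that(1)] that(2) by simp
  have coin: "coin_system (C (3 * r))"
  proof -
    have "sorted_wrt (<) (C (3 * r))"
      unfolding sorted_wrt_iff_nth_less by (auto simp: C_def intro!: less simp del: upt_Suc)
    moreover have "C (3 * r) = e 1 # map e [2..<3 * r + 1]"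
      using assms(1) by (simp add: C_def upt_conv_Cons numeral_2_eq_2 del: upt_Suc)
    ultimately show ?thesis using assms(4) by (simp add: coin_system_def)
  qed
  have take_C: "take i (C (3 * r)) = C i" if "i \<le> 3 * r" for i
    using that by (simp add: C_def take_map add.commute del: upt_Suc)

  \<comment> \<open>Orderly and non-orderly prefixes, and the pattern\<close>
  have orderly_C: "orderly (C i)" if "i = 1 \<or> i = 2 \<or> i = 3 \<or> i = 3 * r" for i
    using that
  proof (elim disjE)
    assume "i = 1"
    then show ?thesis using assms(4) by (intro orderly_pair[of _ 1]) (auto simp: set_C)
  next
    assume "i = 2"
    then have "{1..i} = {1, 2}" by auto
    then show ?thesis using assms(2-5) by (intro orderly_pair[of _ a]) (auto simp: set_C)
  next
    assume "i = 3"
    then have "{1..i} = {1, 2, 3}" by auto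
    then show ?thesis using assms(1,4) e_low[of 0]
      by (intro short.orderly_coins) (auto simp: set_C short.coins_def numeral_eq_Suc)
  next
    assume i: "i = 3 * r"
    have "set (C i) = coins"
    proof
      show "set (C i) \<subseteq> coins" using e_coins by (auto simp: set_C i)
      show "coins \<subseteq> set (C i)"
      proof
        fix c assume "c \<in> coins"
        then show "c \<in> set (C i)"
        proof (cases rule: coin_cases)
          case 1
          then show ?thesis using memb_C[of i] assms(1) i by simp
        next
          case (2 j)
          then show ?thesis using w_memb[of j i] assms(1) i by simp
        next
          case (3 j)
          then show ?thesis
            using u_memb[of j i] u_memb'[of "j - (r - 1)" i] assms(1) i by (cases "j < r") auto
        qed
      qed
    qed
    then show ?thesis by (rule orderly_coins)
  qed
  have not_orderly_C: "\<not> orderly (C k)" if k: "4 \<le> k" "k < 3 * r" for k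
  proof -
    have "1 \<le> k" "k \<le> 3 * r" using k by auto
    then show ?thesis
    proof (rule index_cases)
      assume "k = 1"
      then show ?thesis using k by simp
    next
      fix j assume j: "j < r" "k = 2 * j + 2"
      then obtain j' where j': "j = Suc j'" using k by (cases j) auto
      show ?thesis
        using max_C[of _ k] C_rows[of k] memb_C[of k] w_memb[of j k] u_memb[of j' k] u_memb[of 0 k]
          e_low[of j] j j' k assms(3)
        by (intro not_orderly_max_w[of _ j']) auto
    next
      fix j assume j: "j < r" "k = 2 * j + 3"
      then have "0 < j" using k by (cases j) auto
      \<comment> \<open>The largest coin is \<open>u j\<close>, and \<open>u (Suc j) + 1\<close> is
        paid by \<open>w j\<close> and \<open>w 1\<close>; the latter stands at position 4, hence in
        the prefix.\<close>
      then show ?thesis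
        using max_C[of _ k] C_rows[of k] memb_C[of k] w_memb[of j k] w_memb[of 1 k] u_memb[of j k]
          e_low[of j] j k assms(1)
        by (intro not_orderly_max_u[of _ "j - 1" 1]) auto
    next
      fix i assume i: "0 < i" "i < r" "k = 2 * r + 1 + i"
      \<comment> \<open>The largest coin is \<open>u (r - 1 + i)\<close>, so the two indices must
        add up to \<open>r + i\<close>; they are \<open>r - 1\<close> and \<open>Suc i\<close>. Here
        \<open>k < 3 * r\<close> gives \<open>Suc i < r\<close>, so \<open>w (Suc i)\<close> is a
        coin; at \<open>k = 3 * r\<close> this would be the missing \<open>w r\<close>.\<close>
      have "Suc (r - 2) = r - 1" "r - 2 + Suc i = r - 1 + i" using assms(1) by auto
      moreover have "w (r - 1) \<in> set (C k)" using w_memb[of "r - 1" k] i assms(1) by simp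
      moreover have "w (Suc i) \<in> set (C k)" using w_memb[of "Suc i" k] i k by simp
      ultimately show ?thesis
        using max_C[of _ k] C_rows[of k] memb_C[of k] u_memb'[of i k] e_high[of i] i k
        by (intro not_orderly_max_u[of _ "r - 2" "Suc i"]) auto
    qed
  qed
  have "pattern (C (3 * r)) = ''+++'' @ replicate (3 * r - 4) CHR ''-'' @ ''+''"
  proof -
    have "[1..<3 * r + 1] = [1, 2, 3] @ [4..<3 * r] @ [3 * r]"
      using assms(1) upt_conv_Cons[of 1 "3 * r"] upt_conv_Cons[of 2 "3 * r"]
        upt_conv_Cons[of 3 "3 * r"] by (simp add: numeral_2_eq_2 numeral_3_eq_3 eval_nat_numeral)
    moreover have "map (\<lambda>i. if orderly (take i (C (3 * r))) then CHR ''+'' else CHR ''-'') [4..<3 * r]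
      = replicate (3 * r - 4) CHR ''-''"
      by (rule replicate_eqI) (auto simp: take_C not_orderly_C)
    moreover have len: "length (C (3 * r)) + 1 = 3 * r + 1" by (simp add: C_def)
    ultimately show ?thesis
      unfolding pattern_def len using assms(1) orderly_C by (simp add: pattern_def take_C C_def[THEN arg_cong, of length])
  qed
  with coin show ?thesis by (simp add: C_def)
qed

end
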